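(* Let $n\ge 1$ be an integer. For any matrix $M\in\mathcal{M}_n$ there exist nonzero vectors $u,v\in\{0,1\}^n$ such that $M^{t}u=v$ (where $M^t$ is the transpose of $M$); that is, there exists a system of rows of $M$ such that their sum is a nonzero, zero-one vector.
   Context: $\mathcal{M}_n$ denotes the set of all integer square matrices of order $n$ with all elements on the main diagonal greater than or equal to $-1$, all elements off the main diagonal non-negative, and all row sums equal to $1$. The vectors $u,v$ are regarded as integer column vectors, and the equality $M^tu=v$ is over the integers. *)

theory Defs
  imports "Jordan_Normal_Form.Matrix"
begin

definition matrix_class :: "nat \<Rightarrow> int mat set" where
  "matrix_class n =
     {M \<in> carrier_mat n n.
        (\<forall>i<n. M $$ (i, i) \<ge> -1) \<and>
        (\<forall>i<n. \<forall>j<n. i \<noteq> j \<longrightarrow> M $$ (i, j) \<ge> 0) \<and>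
        (\<forall>i<n. (\<Sum>j<n. M $$ (i, j)) = 1)}"

definition zero_one_vecs :: "nat \<Rightarrow> int vec set" where
  "zero_one_vecs n = {u \<in> carrier_vec n. \<forall>i<n. u $ i \<in> {0, 1}}"

end

theory Submission
  imports Defs
begin

text \<open>
  A system of rows is a nonempty set \<open>S\<close> of row indices, and the claim is that \<open>S\<close> can be chosen so that
  every column sum over \<open>S\<close> is 0 or 1; the resulting vector is then nonzero, because its entries
  add up to \<open>card S\<close>. To allow deletion of an index, the argument works over an arbitrary
  finite index set \<open>V\<close> and is an induction on \<open>card V\<close>.

  If a diagonal entry is nonnegative, its row has nonnegative entries with sum 1, so this row
  alone is a zero-one vector. Otherwise every row has the form \<open>- e\<^sub>i + e\<^sub>j + e\<^sub>k\<close> with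
  \<open>j, k \<noteq> i\<close>. The column sums over all of \<open>V\<close> have average 1. Hence either they are all equal
  to 1, and all rows together will do, or some column \<open>w\<close> has sum at most 0. In the latter case
  the off-diagonal entries of column \<open>w\<close> are all 0, or exactly one of them, in a row \<open>p\<close>, is
  nonzero, and it equals 1. In the first situation row and column \<open>w\<close> can simply be deleted.
  In the second, row \<open>p\<close> is \<open>- e\<^sub>p + e\<^sub>w + e\<^sub>q\<close>; delete \<open>w\<close> and
  replace row \<open>p\<close> by \<open>- e\<^sub>p + 2 e\<^sub>q\<close>. If a solution \<open>S\<close> of the smaller system contains
  \<open>p\<close>, then its sum in column \<open>q\<close> is at least \<open>2 - 1\<close>, because the only negative entry of that
  column is the \<open>-1\<close> on the diagonal; so the sum is exactly 1. Changing row \<open>p\<close> back moves one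
  unit from column \<open>q\<close> to column \<open>w\<close>, and the sums there become 0 and 1. If \<open>S\<close> does not contain
  \<open>p\<close>, nothing changes.
\<close>

lemma nonneg_int_sum_eq_1E:
  fixes f :: "'a \<Rightarrow> int"
  assumes "finite A" "\<And>x. x \<in> A \<Longrightarrow> f x \<ge> 0" "sum f A = 1"
  obtains q where "q \<in> A" "f q = 1" "\<And>x. x \<in> A \<Longrightarrow> x \<noteq> q \<Longrightarrow> f x = 0"
proof -
  obtain q where q: "q \<in> A" "f q \<noteq> 0"
    using assms(3) by (metis sum.neutral zero_neq_one)
  have split: "sum f A = f q + sum f (A - {q})"
    using assms(1) q(1) by (rule sum.remove)
  have rest: "sum f (A - {q}) \<ge> 0"
    using assms(2) by (intro sum_nonneg) auto
  have "f q = 1"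
    using split rest assms(2)[OF q(1)] assms(3) q(2) by linarith
  moreover from this have "sum f (A - {q}) = 0"
    using split assms(3) by linarith
  then have "\<forall>x\<in>A - {q}. f x = 0"
    using assms(1,2) by (subst (asm) sum_nonneg_eq_0_iff) auto
  ultimately show ?thesis
    using that q(1) by auto
qed

text \<open>
  The indices form an arbitrary finite set because the induction removes one that cannot be
  chosen in advance. The matrix must vary in the induction as well, since after the removal
  one row has a different entry.
\<close>

lemma exists_rows_with_zero_one_sum:
  fixes a :: "'a \<Rightarrow> 'a \<Rightarrow> int"
  assumes "finite V" "V \<noteq> {}"
    and "\<And>i. i \<in> V \<Longrightarrow> a i i \<ge> -1"
    and "\<And>i j. i \<in> V \<Longrightarrow> j \<in> V \<Longrightarrow> i \<noteq> j \<Longrightarrow> a i j \<ge> 0"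
    and "\<And>i. i \<in> V \<Longrightarrow> (\<Sum>j\<in>V. a i j) = 1"
  shows "\<exists>S. S \<subseteq> V \<and> S \<noteq> {} \<and> (\<forall>j\<in>V. (\<Sum>i\<in>S. a i j) \<in> {0, 1})"
  using assms
proof (induction "card V" arbitrary: V a rule: less_induct)
  case less
  note fin = less.prems(1) and ne = less.prems(2) and diag = less.prems(3)
    and off = less.prems(4) and rows = less.prems(5)
  consider (single) i where "i \<in> V" "a i i \<ge> 0"
    | (all) "\<forall>w\<in>V. (\<Sum>i\<in>V. a i w) \<ge> 1"
    | (col) w where "w \<in> V" "(\<Sum>i\<in>V. a i w) \<le> 0" "\<forall>i\<in>V. a i i = -1"
  proof -
    have "a i i = -1" if "i \<in> V" "\<not> a i i \<ge> 0" for i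
      using diag[OF that(1)] that(2) by linarith
    then show ?thesis
      using single all col by (metis linorder_not_le int_one_le_iff_zero_less)
  qed
  then show ?case
  proof cases
    case single
    have nonneg: "a i j \<ge> 0" if "j \<in> V" for j
      using single off that by (cases "i = j") auto
    obtain q where "q \<in> V" "a i q = 1" "\<And>j. j \<in> V \<Longrightarrow> j \<noteq> q \<Longrightarrow> a i j = 0"
      using nonneg_int_sum_eq_1E[OF fin nonneg rows[OF single(1)]] by blast
    then have "\<forall>j\<in>V. a i j \<in> {0, 1}"
      by auto
    then show ?thesis
      using single(1) by (intro exI[of _ "{i}"]) simp
  next
    case all
    have "(\<Sum>w\<in>V. \<Sum>i\<in>V. a i w) = (\<Sum>i\<in>V. \<Sum>w\<in>V. a i w)"
      by (rule sum.swap)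
    also have "\<dots> = (\<Sum>i\<in>V. 1)"
      using rows by (intro sum.cong) auto
    finally have "(\<Sum>w\<in>V. (\<Sum>i\<in>V. a i w) - 1) = 0"
      by (simp add: sum_subtractf)
    then have "\<forall>w\<in>V. (\<Sum>i\<in>V. a i w) - 1 = 0"
      using fin all by (subst (asm) sum_nonneg_eq_0_iff) auto
    then show ?thesis
      using ne by (intro exI[of _ V]) auto
  next
    case col
    note w = col(1)
    define W where "W = V - {w}"
    have finW: "finite W" and wW: "w \<notin> W" and VW: "V = insert w W"
      and less_card: "card W < card V"
      using fin w card_Diff1_less[OF fin w] by (auto simp: W_def)
    \<comment> \<open>If \<open>w\<close> were the only index, its row sum would be \<open>-1\<close>.\<close>
    have neW: "W \<noteq> {}"
      using rows[OF w] col(3) VW w by auto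
    have row_split: "a i w + (\<Sum>j\<in>W. a i j) = 1" if "i \<in> V" for i
      using rows[OF that] VW finW wW by simp
    have colW: "(\<Sum>i\<in>W. a i w) \<le> 1"
      using col(2,3) w VW finW wW by simp
    have colW_nonneg: "a i w \<ge> 0" if "i \<in> W" for i
      using off[of i w] that w VW wW by auto
    have "(\<Sum>i\<in>W. a i w) \<ge> 0"
      using colW_nonneg by (rule sum_nonneg)
    then consider (zero) "(\<Sum>i\<in>W. a i w) = 0" | (one) "(\<Sum>i\<in>W. a i w) = 1"
      using colW by linarith
    then show ?thesis
    proof cases
      case zero
      then have z: "a i w = 0" if "i \<in> W" for i
        using sum_nonneg_eq_0_iff[OF finW colW_nonneg] that by auto
      have "\<exists>S. S \<subseteq> W \<and> S \<noteq> {} \<and> (\<forall>j\<in>W. (\<Sum>i\<in>S. a i j) \<in> {0, 1})"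
      proof (rule less.hyps[OF less_card finW neW])
        show "a i i \<ge> -1" if "i \<in> W" for i
          using diag[of i] that VW by auto
        show "a i j \<ge> 0" if "i \<in> W" "j \<in> W" "i \<noteq> j" for i j
          using off[of i j] that VW by auto
        show "(\<Sum>j\<in>W. a i j) = 1" if "i \<in> W" for i
          using row_split[of i] z[of i] that VW by auto
      qed
      then obtain S where S: "S \<subseteq> W" "S \<noteq> {}" "\<forall>j\<in>W. (\<Sum>i\<in>S. a i j) \<in> {0, 1}"
        by blast
      have "(\<Sum>i\<in>S. a i w) = 0"
        using S(1) z by (intro sum.neutral) auto
      then show ?thesis
        using S VW by (intro exI[of _ S]) auto
    next
      case one
      obtain p where p: "p \<in> W" "a p w = 1" "\<And>i. i \<in> W \<Longrightarrow> i \<noteq> p \<Longrightarrow> a i w = 0"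
        using nonneg_int_sum_eq_1E[OF finW colW_nonneg one] by blast
      define P where "P = W - {p}"
      have finP: "finite P" and pP: "p \<notin> P" and WP: "W = insert p P"
        using finW p(1) by (auto simp: P_def)
      have "(\<Sum>j\<in>P. a p j) = 1"
        using row_split[of p] p(1,2) col(3) VW WP finP pP by simp
      moreover have "a p j \<ge> 0" if "j \<in> P" for j
        using off[of p j] that p(1) VW WP pP by auto
      ultimately obtain q where q: "q \<in> P" "a p q = 1"
        using nonneg_int_sum_eq_1E[OF finP] by metis
      have pq: "p \<noteq> q" and qW: "q \<in> W"
        using q(1) pP WP by auto
      \<comment> \<open>On \<open>W\<close>, row \<open>p\<close> has lost its entry 1 in column \<open>w\<close>; giving this unit to column \<open>q\<close>
        restores the row sum and leaves every other row alone.\<close>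
      define b where "b i j = a i j + (if i = p \<and> j = q then 1 else 0)" for i j
      have sum_b: "(\<Sum>i\<in>S. b i j) = (\<Sum>i\<in>S. a i j) + (if p \<in> S \<and> j = q then 1 else 0)"
        if "S \<subseteq> W" for S j
        using finite_subset[OF that finW]
        by (cases "j = q") (simp_all add: b_def sum.distrib)
      have row_b: "(\<Sum>j\<in>W. b i j) = 1" if "i \<in> W" for i
      proof -
        have "(\<Sum>j\<in>W. b i j) = (\<Sum>j\<in>W. a i j) + (if i = p then 1 else 0)"
          using finW qW by (cases "i = p") (simp_all add: b_def sum.distrib)
        moreover have "a i w = (if i = p then 1 else 0)"
          using p that by auto
        ultimately show ?thesis
          using row_split[of i] that VW by auto
      qed
      have "\<exists>S. S \<subseteq> W \<and> S \<noteq> {} \<and> (\<forall>j\<in>W. (\<Sum>i\<in>S. b i j) \<in> {0, 1})"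
      proof (rule less.hyps[OF less_card finW neW])
        show "b i i \<ge> -1" if "i \<in> W" for i
          using diag[of i] that VW pq by (auto simp: b_def)
        show "b i j \<ge> 0" if "i \<in> W" "j \<in> W" "i \<noteq> j" for i j
          using off[of i j] that VW by (auto simp: b_def)
      qed (rule row_b)
      then obtain S where S: "S \<subseteq> W" "S \<noteq> {}" "\<forall>j\<in>W. (\<Sum>i\<in>S. b i j) \<in> {0, 1}"
        by blast
      have finS: "finite S"
        using S(1) finW by (rule finite_subset)
      have "(\<Sum>i\<in>S. a i w) = (\<Sum>i\<in>S. if i = p then 1 else 0)"
        using S(1) p by (intro sum.cong) auto
      then have w_sum: "(\<Sum>i\<in>S. a i w) \<in> {0, 1}"
        using finS by simp
      have q_sum: "(\<Sum>i\<in>S. a i q) \<ge> 0" if "p \<in> S"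
      proof -
        \<comment> \<open>Row \<open>p\<close> compensates the \<open>-1\<close> on the diagonal.\<close>
        have "(\<Sum>i\<in>S. (if i = p then 1 else 0) + (if i = q then -1 else 0)) \<le> (\<Sum>i\<in>S. a i q)"
        proof (rule sum_mono)
          fix i assume "i \<in> S"
          then have "i \<in> V"
            using S(1) VW by auto
          then show "(if i = p then 1 else 0) + (if i = q then -1 else 0) \<le> a i q"
            using off[of i q] diag[of q] q(2) pq qW VW by auto
        qed
        then show ?thesis
          using finS that by (simp add: sum.distrib split: if_splits)
      qed
      have "(\<Sum>i\<in>S. a i j) \<in> {0, 1}" if "j \<in> W" for j
        using S(3)[rule_format, OF that] sum_b[OF S(1), of j] q_sum
        by (cases "p \<in> S \<and> j = q") auto
      then show ?thesis
        using S(1,2) w_sum VW by (intro exI[of _ S]) auto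
    qed
  qed
qed

theorem lemma1:
  fixes n :: nat and M :: "int mat"
  assumes "n \<ge> 1"
    and "M \<in> matrix_class n"
  shows "\<exists>u \<in> zero_one_vecs n. \<exists>v \<in> zero_one_vecs n.
           u \<noteq> 0\<^sub>v n \<and> v \<noteq> 0\<^sub>v n \<and> transpose_mat M *\<^sub>v u = v"
proof -
  have M: "M \<in> carrier_mat n n"
    and diag: "\<And>i. i < n \<Longrightarrow> M $$ (i, i) \<ge> -1"
    and off: "\<And>i j. i < n \<Longrightarrow> j < n \<Longrightarrow> i \<noteq> j \<Longrightarrow> M $$ (i, j) \<ge> 0"
    and rows: "\<And>i. i < n \<Longrightarrow> (\<Sum>j<n. M $$ (i, j)) = 1"
    using assms(2) by (auto simp: matrix_class_def)
  have "\<exists>S. S \<subseteq> {..<n} \<and> S \<noteq> {} \<and> (\<forall>j\<in>{..<n}. (\<Sum>i\<in>S. M $$ (i, j)) \<in> {0, 1})"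
    using assms(1) diag off rows
    by (intro exists_rows_with_zero_one_sum) (auto simp: lessThan_empty_iff)
  then obtain S where S: "S \<subseteq> {..<n}" "S \<noteq> {}"
    and S01: "\<And>j. j < n \<Longrightarrow> (\<Sum>i\<in>S. M $$ (i, j)) \<in> {0, 1}"
    by auto
  have finS: "finite S"
    using S(1) by (rule finite_subset) simp
  define u :: "int vec" where "u = vec n (\<lambda>i. if i \<in> S then 1 else 0)"
  define v where "v = transpose_mat M *\<^sub>v u"
  have v_carrier: "v \<in> carrier_vec n"
    unfolding v_def using M by (intro mult_mat_vec_carrier[of _ n n]) (simp_all add: u_def)
  have v_index: "v $ j = (\<Sum>i\<in>S. M $$ (i, j))" if "j < n" for j
  proof -
    have "v $ j = (\<Sum>i = 0..<n. M $$ (i, j) * (if i \<in> S then 1 else 0))"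
      using M that by (simp add: v_def u_def scalar_prod_def)
    also have "\<dots> = (\<Sum>i = 0..<n. if i \<in> S then M $$ (i, j) else 0)"
      by (rule sum.cong) simp_all
    also have "\<dots> = (\<Sum>i\<in>{0..<n} \<inter> S. M $$ (i, j))"
      by (simp add: sum.inter_restrict)
    also have "{0..<n} \<inter> S = S"
      using S(1) by auto
    finally show ?thesis .
  qed
  have "u \<in> zero_one_vecs n"
    by (simp add: zero_one_vecs_def u_def)
  moreover have "v \<in> zero_one_vecs n"
    unfolding zero_one_vecs_def using v_carrier S01 by (simp add: v_index)
  moreover have "u \<noteq> 0\<^sub>v n"
  proof
    obtain i where i: "i \<in> S" "i < n"
      using S by auto
    assume "u = 0\<^sub>v n"
    then have "u $ i = 0"
      using i(2) by simp
    then show False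
      using i by (simp add: u_def)
  qed
  \<comment> \<open>Every row sum is 1, so the entries of \<open>v\<close> add up to \<open>card S\<close>.\<close>
  moreover have "v \<noteq> 0\<^sub>v n"
  proof
    assume "v = 0\<^sub>v n"
    then have "0 = (\<Sum>j<n. v $ j)"
      by simp
    also have "\<dots> = (\<Sum>j<n. \<Sum>i\<in>S. M $$ (i, j))"
      by (intro sum.cong) (simp_all add: v_index)
    also have "\<dots> = (\<Sum>i\<in>S. \<Sum>j<n. M $$ (i, j))"
      by (rule sum.swap)
    also have "\<dots> = (\<Sum>i\<in>S. 1)"
      using S(1) rows by (intro sum.cong) auto
    finally show False
      using finS S(2) by simp
  qed
  ultimately show ?thesis
    using v_def by blast
qed

end
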